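(* Let $\mathcal{U}$ be an ultrafilter on a complete Boolean algebra $\mathcal{B}$. Then $\lambda_{\mathcal{U}}(\Delta(FDP))$ is the least cardinal $\lambda$ such that $\mathcal{U}$ is not $\lambda$-OK. Additionally, if $\mathcal{U}$ is $\aleph_1$-incomplete, then $\lambda_{\mathcal U}(\Delta(FDP))$ is the least $\lambda$ such that $\mathcal{U}$ is not $\lambda$-flexible.
   Context: A $\lambda$-distribution in $\mathcal B$ is $\mathbf A:[\lambda]^{<\aleph_0}\to\mathcal B_+$ with $\mathbf A(\emptyset)=1$ and $s\subseteq t\Rightarrow\mathbf A(s)\ge\mathbf A(t)$; it is in $\mathcal U$ if its image lies in $\mathcal U$; $\mathbf B$ refines $\mathbf A$ if $\mathbf B(s)\le\mathbf A(s)$ for all $s$; $\mathbf A$ is multiplicative if $\mathbf A(s)=\bigwedge_{\alpha\in s}\mathbf A(\{\alpha\})$. For a pattern $\Delta$ (subset-closed subset of $[I]^{<\aleph_0}$), $\mathbf A$ is a $(\lambda,\Delta)$-distribution if for every finite $s\subseteq\lambda$ and $\mathbf c\in\mathcal B_+$ deciding each $\mathbf A(t)$ ($t\subseteq s$; i.e. $\mathbf c\le\mathbf A(t)$ or $\mathbf c\wedge\mathbf A(t)=0$), there is $f:s\to I$ with $\mathbf c\le\mathbf A(t)$ iff $f[t]\in\Delta$ for all $t\subseteq s$. $\lambda_{\mathcal U}(\Delta)$ is the least $\lambda$ such that some $(\lambda,\Delta)$-distribution in $\mathcal U$ has no multiplicative refinement in $\mathcal U$ ($\infty$ if none). $\Delta(FDP)$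 is the pattern on $(\omega\setminus\{0\})\times\omega$ of finite $s$ with $s\subseteq\{m\}\times\omega$ and $|s|\le m$ for some $m\ge1$. $\mathcal U$ is $\lambda$-OK if every $\lambda$-distribution $\mathbf A$ in $\mathcal U$ with $\mathbf A(s)=\mathbf A(t)$ whenever $|s|=|t|$ has a multiplicative refinement in $\mathcal U$. $\mathcal U$ is $\aleph_1$-incomplete if some countable subset of $\mathcal U$ has meet $0$. $(\omega,<)^{\mathcal B}$ is the set of maps $\mathbf n:\omega\to\mathcal B$ with pairwise disjoint values and join $1$, with $\|\mathbf n\ge n\|=\bigvee_{m\ge n}\mathbf n(m)$; $\mathbf n$ is $\mathcal U$-nonstandard if $\|\mathbf n\ge n\|\in\mathcal U$ for all $n<\omega$. $\mathcal U$ is $\lambda$-flexible if it is $\aleph_1$-incomplete and for every $\mathcal U$-nonstandard $\mathbf n\in(\omega,<)^{\mathcal B}$ there is a multiplicative $\lambda$-distribution $\mathbf B$ in $\mathcal U$ with $\mathbf B(s)\le\|\mathbf n\ge|s|\|$ for all finite $s\subseteq\lambda$. *)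

theory Defs
  imports Main "HOL-Library.Countable_Set"
begin

unbundle cardinal_syntax

text \<open>
  A complete Boolean algebra is a type of sort \<open>{boolean_algebra, complete_lattice}\<close>.
  The library class \<open>complete_boolean_algebra\<close> would be wrong here: it extends
  \<open>complete_distrib_lattice\<close>, hence demands complete distributivity, which makes
  the algebra atomic.
\<close>

definition ultrafilter :: "'b::boolean_algebra set \<Rightarrow> bool" where
  "ultrafilter U \<longleftrightarrow>
     top \<in> U \<and> bot \<notin> U \<and>
     (\<forall>a\<in>U. \<forall>b. a \<le> b \<longrightarrow> b \<in> U) \<and>
     (\<forall>a\<in>U. \<forall>b\<in>U. inf a b \<in> U) \<and>
     (\<forall>a. a \<in> U \<or> - a \<in> U)"

text \<open>
  A cardinal \<open>\<lambda>\<close> is a relation \<open>\<kappa> :: 'l rel\<close> with \<open>Card_order \<kappa>\<close>, and its set of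
  elements is \<open>L = Field \<kappa>\<close>. The set \<open>[\<lambda>]\<^bsup><\<omega>\<^esup>\<close> of its finite subsets is \<open>Fpow L\<close>.
  Distributions are total functions on \<open>'l set\<close> of which only the values on \<open>Fpow L\<close> matter.
\<close>

definition distribution ::
  "'l set \<Rightarrow> ('l set \<Rightarrow> 'b::{boolean_algebra, complete_lattice}) \<Rightarrow> bool" where
  "distribution L A \<longleftrightarrow>
     (\<forall>s\<in>Fpow L. A s \<noteq> bot) \<and> A {} = top \<and>
     (\<forall>s\<in>Fpow L. \<forall>t\<in>Fpow L. s \<subseteq> t \<longrightarrow> A t \<le> A s)"

definition distribution_in ::
  "'b set \<Rightarrow> 'l set \<Rightarrow> ('l set \<Rightarrow> 'b::{boolean_algebra, complete_lattice}) \<Rightarrow> bool" where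
  "distribution_in U L A \<longleftrightarrow> distribution L A \<and> A ` Fpow L \<subseteq> U"

definition refines ::
  "'l set \<Rightarrow> ('l set \<Rightarrow> 'b::{boolean_algebra, complete_lattice}) \<Rightarrow> ('l set \<Rightarrow> 'b) \<Rightarrow> bool" where
  "refines L B A \<longleftrightarrow> (\<forall>s\<in>Fpow L. B s \<le> A s)"

definition multiplicative ::
  "'l set \<Rightarrow> ('l set \<Rightarrow> 'b::{boolean_algebra, complete_lattice}) \<Rightarrow> bool" where
  "multiplicative L A \<longleftrightarrow> (\<forall>s\<in>Fpow L. A s = (INF \<alpha>\<in>s. A {\<alpha>}))"

definition has_multiplicative_refinement ::
  "'b set \<Rightarrow> 'l set \<Rightarrow> ('l set \<Rightarrow> 'b::{boolean_algebra, complete_lattice}) \<Rightarrow> bool" where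
  "has_multiplicative_refinement U L A \<longleftrightarrow>
     (\<exists>B. distribution_in U L B \<and> multiplicative L B \<and> refines L B A)"

definition pattern :: "'i set \<Rightarrow> 'i set set \<Rightarrow> bool" where
  "pattern I \<Delta> \<longleftrightarrow> \<Delta> \<subseteq> Fpow I \<and> (\<forall>s\<in>\<Delta>. \<forall>t\<subseteq>s. t \<in> \<Delta>)"

definition decides :: "'b::{boolean_algebra, complete_lattice} \<Rightarrow> 'b \<Rightarrow> bool" where
  "decides c a \<longleftrightarrow> c \<le> a \<or> inf c a = bot"

definition pattern_distribution ::
  "'l set \<Rightarrow> 'i set \<Rightarrow> 'i set set \<Rightarrow> ('l set \<Rightarrow> 'b::{boolean_algebra, complete_lattice}) \<Rightarrow> bool" where
  "pattern_distribution L I \<Delta> A \<longleftrightarrow>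
     distribution L A \<and>
     (\<forall>s\<in>Fpow L. \<forall>c. c \<noteq> bot \<and> (\<forall>t\<subseteq>s. decides c (A t)) \<longrightarrow>
        (\<exists>f. f ` s \<subseteq> I \<and> (\<forall>t\<subseteq>s. c \<le> A t \<longleftrightarrow> f ` t \<in> \<Delta>)))"

text \<open>
  The least cardinal with property \<open>P\<close>, as an element of the cardinals extended by \<open>\<infinity>\<close>.
  A cardinal is only determined up to \<open>=o\<close>, so the value is the \<open>=o\<close>-class of all card orders
  on \<open>'l\<close> representing it, and \<open>{}\<close> stands for \<open>\<infinity>\<close> (no cardinal satisfies \<open>P\<close>);
  see the two lemmas after the definition.
  The card orders on \<open>'l\<close> are the cardinals up to the cardinality of \<open>'l\<close> (the finite ones
  included), so that \<open>\<infinity>\<close> means that there is none among these. All cardinals are covered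
  because \<open>'l\<close> is an arbitrary type in every statement below.
\<close>

definition least_cardinal :: "('l rel \<Rightarrow> bool) \<Rightarrow> 'l rel set" where
  "least_cardinal P =
     {\<kappa>. Card_order \<kappa> \<and> P \<kappa> \<and> (\<forall>\<mu>. Card_order \<mu> \<and> P \<mu> \<longrightarrow> \<kappa> \<le>o \<mu>)}"

lemma least_cardinal_empty_iff:
  "least_cardinal P = {} \<longleftrightarrow> \<not> (\<exists>\<kappa>. Card_order \<kappa> \<and> P \<kappa>)"
  using exists_minim_Card_order[of "{\<kappa>. Card_order \<kappa> \<and> P \<kappa>}"]
  unfolding least_cardinal_def by blast

lemma least_cardinal_unique:
  fixes P :: "'l rel \<Rightarrow> bool"
  assumes "\<And>\<kappa> \<mu>. Card_order \<kappa> \<Longrightarrow> Card_order \<mu> \<Longrightarrow> \<kappa> =o \<mu> \<Longrightarrow> P \<kappa> \<Longrightarrow> P \<mu>"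
    and "\<kappa> \<in> least_cardinal P"
  shows "least_cardinal P = {\<mu>. \<mu> =o \<kappa>}"
proof (intro set_eqI iffI)
  fix \<mu> :: "'l rel" assume "\<mu> \<in> least_cardinal P"
  with assms(2) show "\<mu> \<in> {\<mu>. \<mu> =o \<kappa>}"
    unfolding least_cardinal_def by (simp add: ordIso_iff_ordLeq)
next
  fix \<mu> :: "'l rel" assume "\<mu> \<in> {\<mu>. \<mu> =o \<kappa>}"
  then have iso: "\<mu> =o \<kappa>" by simp
  have \<kappa>: "Card_order \<kappa>" "P \<kappa>" "\<And>\<nu>. Card_order \<nu> \<Longrightarrow> P \<nu> \<Longrightarrow> \<kappa> \<le>o \<nu>"
    using assms(2) unfolding least_cardinal_def by simp_all
  have "Card_order \<mu>"
    using \<kappa>(1) iso by (rule Card_order_ordIso)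
  moreover from this have "P \<mu>"
    using assms(1)[OF \<kappa>(1) _ ordIso_symmetric[OF iso] \<kappa>(2)] by simp
  moreover have "\<mu> \<le>o \<nu>" if "Card_order \<nu>" "P \<nu>" for \<nu>
    using iso \<kappa>(3)[OF that] by (rule ordIso_ordLeq_trans)
  ultimately show "\<mu> \<in> least_cardinal P"
    unfolding least_cardinal_def by simp
qed

definition lambda_of ::
  "'b::{boolean_algebra, complete_lattice} set \<Rightarrow> 'i set \<Rightarrow> 'i set set \<Rightarrow> 'l rel set" where
  "lambda_of U I \<Delta> = least_cardinal (\<lambda>\<kappa>.
     \<exists>A. pattern_distribution (Field \<kappa>) I \<Delta> A \<and> distribution_in U (Field \<kappa>) A \<and>
         \<not> has_multiplicative_refinement U (Field \<kappa>) A)"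

definition FDP_index :: "(nat \<times> nat) set" where
  "FDP_index = (UNIV - {0}) \<times> UNIV"

definition FDP :: "(nat \<times> nat) set set" where
  "FDP = {s. finite s \<and> (\<exists>m\<ge>1. s \<subseteq> {m} \<times> UNIV \<and> card s \<le> m)}"

lemma pattern_FDP: "pattern FDP_index FDP"
  unfolding pattern_def
proof (intro conjI ballI allI impI)
  show "FDP \<subseteq> Fpow FDP_index"
    by (fastforce simp: FDP_def FDP_index_def Fpow_def)
next
  fix s t :: "(nat \<times> nat) set"
  assume "s \<in> FDP" and ts: "t \<subseteq> s"
  then obtain m where "finite s" "m \<ge> 1" "s \<subseteq> {m} \<times> UNIV" "card s \<le> m"
    by (auto simp: FDP_def)
  with ts card_mono[of s t] have "finite t" "t \<subseteq> {m} \<times> UNIV" "card t \<le> m"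
    by (auto intro: finite_subset)
  with \<open>m \<ge> 1\<close> show "t \<in> FDP"
    by (auto simp: FDP_def)
qed

definition OK :: "'b::{boolean_algebra, complete_lattice} set \<Rightarrow> 'l set \<Rightarrow> bool" where
  "OK U L \<longleftrightarrow>
     (\<forall>A. distribution_in U L A \<and> (\<forall>s\<in>Fpow L. \<forall>t\<in>Fpow L. card s = card t \<longrightarrow> A s = A t)
        \<longrightarrow> has_multiplicative_refinement U L A)"

definition aleph1_incomplete :: "'b::{boolean_algebra, complete_lattice} set \<Rightarrow> bool" where
  "aleph1_incomplete U \<longleftrightarrow> (\<exists>X\<subseteq>U. countable X \<and> Inf X = bot)"

text \<open>The elements of \<open>(\<omega>, <)\<^bsup>\<B>\<^esup>\<close>, that is, names for natural numbers:\<close>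

definition nat_names :: "(nat \<Rightarrow> 'b::{boolean_algebra, complete_lattice}) set" where
  "nat_names = {n. (\<forall>i j. i \<noteq> j \<longrightarrow> inf (n i) (n j) = bot) \<and> (SUP i. n i) = top}"

text \<open>The Boolean value \<open>\<parallel>n \<ge> k\<parallel>\<close>:\<close>

definition val_ge :: "(nat \<Rightarrow> 'b::{boolean_algebra, complete_lattice}) \<Rightarrow> nat \<Rightarrow> 'b" where
  "val_ge n k = (SUP m\<in>{k..}. n m)"

definition nonstandard ::
  "'b set \<Rightarrow> (nat \<Rightarrow> 'b::{boolean_algebra, complete_lattice}) \<Rightarrow> bool" where
  "nonstandard U n \<longleftrightarrow> (\<forall>k. val_ge n k \<in> U)"

definition flexible :: "'b::{boolean_algebra, complete_lattice} set \<Rightarrow> 'l set \<Rightarrow> bool" where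
  "flexible U L \<longleftrightarrow>
     aleph1_incomplete U \<and>
     (\<forall>n\<in>nat_names. nonstandard U n \<longrightarrow>
        (\<exists>B. distribution_in U L B \<and> multiplicative L B \<and>
             (\<forall>s\<in>Fpow L. B s \<le> val_ge n (card s))))"

end

theory Submission
  imports Defs
begin

text \<open>
  The properties whose least cardinals are compared coincide for each \<open>L = Field \<kappa>\<close> separately.

  A distribution depending only on \<open>|s|\<close> is, once its values on singletons are replaced
  by \<open>1\<close>, an FDP-distribution: the column is the largest size that is still accepted. Conversely,
  let \<open>A\<close> be an FDP-distribution in \<open>U\<close> and fix a point \<open>p\<close>. If for each \<open>j\<close> it is \<open>U\<close>-true that
  all sets of at most \<open>j\<close> points in the column of \<open>p\<close> are accepted, then \<open>A\<close> is refined, up to the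
  values \<open>A {p, \<alpha>}\<close>, by a distribution depending only on \<open>|s|\<close>. Otherwise take the least \<open>j\<close> such that,
  for some finite \<open>t\<close> containing \<open>p\<close>, it is \<open>U\<close>-true that some \<open>j\<close> points of the column make \<open>t\<close> too
  large. Minimality means that it is \<open>U\<close>-true for each \<open>\<alpha>\<close> that adding \<open>\<alpha>\<close> to \<open>t\<close> yields no new
  point of the column; these truth values give the multiplicative refinement, since \<open>t\<close> itself is
  accepted.

  For flexibility, \<open>\<aleph>\<^sub>1\<close>-incompleteness lets one shrink a decreasing sequence in \<open>U\<close> to one with meet
  \<open>0\<close>, and such sequences are precisely the sequences \<open>\<parallel>n \<ge> k\<parallel>\<close> of nonstandard names.
\<close>

section \<open>Complete Boolean algebras and ultrafilters\<close>

text \<open>If \<open>c\<close> were disjoint from every \<open>a i\<close>, then \<open>- c\<close>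
  would bound the join, giving \<open>c \<le> - c\<close>. Complements do the work of
  distributivity.\<close>

lemma inf_neq_bot_if_le_SUP:
  fixes c :: "'b::{boolean_algebra, complete_lattice}"
  assumes "c \<noteq> bot" "c \<le> (SUP i\<in>I. a i)"
  obtains i where "i \<in> I" "inf c (a i) \<noteq> bot"
proof (rule ccontr)
  assume "\<not> thesis"
  then have "inf c (a i) = bot" if "i \<in> I" for i
    using that \<open>\<And>i. i \<in> I \<Longrightarrow> inf c (a i) \<noteq> bot \<Longrightarrow> thesis\<close> by blast
  then have "(SUP i\<in>I. a i) \<le> - c"
    by (intro SUP_least) (simp add: inf_commute flip: inf_shunt)
  then have "c \<le> - c" using assms(2) by (rule order_trans[rotated])
  then show False using assms(1) by (metis inf.absorb1 inf_compl_bot)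
qed

text \<open>Treat the elements one by one: meet with \<open>x\<close> if the meet is nonzero,
  otherwise \<open>x\<close> is already rejected. Decisions persist to smaller elements. This
  supplies the deciding elements on which the pattern condition can be evaluated.\<close>

lemma exists_deciding:
  fixes c :: "'b::{boolean_algebra, complete_lattice}"
  assumes "finite T" "c \<noteq> bot"
  obtains d where "d \<noteq> bot" "d \<le> c" "\<forall>x\<in>T. decides d x"
proof -
  from assms(1) have "\<exists>d. d \<noteq> bot \<and> d \<le> c \<and> (\<forall>x\<in>T. decides d x)"
  proof (induction T)
    case empty
    then show ?case using assms(2) by auto
  next
    case (insert x T)
    then obtain d where d: "d \<noteq> bot" "d \<le> c" "\<forall>x\<in>T. decides d x" by auto
    show ?case
    proof (cases "inf d x = bot")
      case True
      then show ?thesis using d by (auto simp: decides_def)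
    next
      case False
      have "decides (inf d x) y" if "y \<in> T" for y
        using d(3) that unfolding decides_def
        by (metis inf.absorb_iff2 inf.coboundedI1 inf_assoc inf_bot_right inf_commute)
      moreover have "decides (inf d x) x" by (simp add: decides_def)
      ultimately show ?thesis using False d(2)
        by (intro exI[of _ "inf d x"]) (auto intro: le_infI1)
    qed
  qed
  then show thesis using that by blast
qed

context
  fixes U :: "'b::{boolean_algebra, complete_lattice} set"
  assumes U: "ultrafilter U"
begin

lemma ultrafilter_top: "top \<in> U"
  and ultrafilter_bot: "bot \<notin> U"
  and ultrafilter_mono: "a \<in> U \<Longrightarrow> a \<le> b \<Longrightarrow> b \<in> U"
  and ultrafilter_inf: "a \<in> U \<Longrightarrow> b \<in> U \<Longrightarrow> inf a b \<in> U"
  and ultrafilter_uminus: "a \<notin> U \<Longrightarrow> - a \<in> U"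
  using U unfolding ultrafilter_def by blast+

lemma ultrafilter_INF:
  assumes "finite s" "\<And>x. x \<in> s \<Longrightarrow> b x \<in> U"
  shows "(INF x\<in>s. b x) \<in> U"
  using assms by (induction s) (auto simp: ultrafilter_top ultrafilter_inf)

lemma ultrafilter_uminus_notin: "a \<in> U \<Longrightarrow> - a \<notin> U"
  using ultrafilter_inf[of a "- a"] ultrafilter_bot by auto

lemma distribution_inI:
  assumes "A {} = top" "\<And>s. s \<in> Fpow L \<Longrightarrow> A s \<in> U"
    and "\<And>s t. t \<in> Fpow L \<Longrightarrow> s \<subseteq> t \<Longrightarrow> A t \<le> A s"
  shows "distribution_in U L A"
proof -
  have "A s \<noteq> bot" if "s \<in> Fpow L" for s
    using assms(2)[OF that] ultrafilter_bot by metis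
  then show ?thesis using assms by (auto simp: distribution_in_def distribution_def)
qed

text \<open>A multiplicative distribution is determined by its values on singletons, and finite
  meets of elements of \<open>U\<close> stay in \<open>U\<close>. Thus from here on a refinement is
  just a family \<open>b\<close> in \<open>U\<close>.\<close>

lemma has_multiplicative_refinement_iff:
  "has_multiplicative_refinement U L A \<longleftrightarrow>
     (\<exists>b. (\<forall>\<alpha>\<in>L. b \<alpha> \<in> U) \<and> (\<forall>s\<in>Fpow L. (INF \<alpha>\<in>s. b \<alpha>) \<le> A s))"
proof
  assume "has_multiplicative_refinement U L A"
  then obtain B where B: "distribution_in U L B" "multiplicative L B" "refines L B A"
    unfolding has_multiplicative_refinement_def by blast
  have "\<forall>\<alpha>\<in>L. B {\<alpha>} \<in> U"
    using B(1) by (auto simp: distribution_in_def Fpow_def)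
  moreover have "\<forall>s\<in>Fpow L. (INF \<alpha>\<in>s. B {\<alpha>}) \<le> A s"
    using B(2,3) unfolding multiplicative_def refines_def by metis
  ultimately show "\<exists>b. (\<forall>\<alpha>\<in>L. b \<alpha> \<in> U) \<and> (\<forall>s\<in>Fpow L. (INF \<alpha>\<in>s. b \<alpha>) \<le> A s)"
    by (intro exI[of _ "\<lambda>\<alpha>. B {\<alpha>}"]) blast
next
  assume "\<exists>b. (\<forall>\<alpha>\<in>L. b \<alpha> \<in> U) \<and> (\<forall>s\<in>Fpow L. (INF \<alpha>\<in>s. b \<alpha>) \<le> A s)"
  then obtain b where b: "\<forall>\<alpha>\<in>L. b \<alpha> \<in> U" "\<forall>s\<in>Fpow L. (INF \<alpha>\<in>s. b \<alpha>) \<le> A s"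
    by blast
  let ?B = "\<lambda>s. INF \<alpha>\<in>s. b \<alpha>"
  have "?B s \<in> U" if "s \<in> Fpow L" for s
    using that b(1) by (intro ultrafilter_INF) (auto simp: Fpow_def)
  then have "distribution_in U L ?B"
    by (intro distribution_inI INF_superset_mono) auto
  moreover have "multiplicative L ?B" "refines L ?B A"
    using b(2) by (auto simp: multiplicative_def refines_def)
  ultimately show "has_multiplicative_refinement U L A"
    unfolding has_multiplicative_refinement_def by blast
qed

section \<open>OK ultrafilters and FDP-distributions\<close>

lemma FDP_column:
  assumes "s \<in> FDP" "(m, k) \<in> s"
  shows "m \<ge> 1" "s \<subseteq> {m} \<times> UNIV" "card s \<le> m"
  using assms by (auto simp: FDP_def)

lemma FDP_iff_card_le:
  assumes "finite s" "s \<subseteq> {m} \<times> UNIV" "m \<ge> 1"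
  shows "s \<in> FDP \<longleftrightarrow> card s \<le> m"
proof
  assume "s \<in> FDP"
  then show "card s \<le> m"
    using assms(2) FDP_column(3)[of s m] by (cases "s = {}") auto
qed (use assms in \<open>auto simp: FDP_def\<close>)

lemma OK_if_FDP_refinements:
  fixes L :: "'l set"
  assumes refinements: "\<And>A :: 'l set \<Rightarrow> 'b. pattern_distribution L FDP_index FDP A \<Longrightarrow>
      distribution_in U L A \<Longrightarrow> has_multiplicative_refinement U L A"
  shows "OK U L"
  unfolding OK_def
proof (intro allI impI, elim conjE)
  fix A :: "'l set \<Rightarrow> 'b"
  assume A: "distribution_in U L A"
    and uniform: "\<forall>s\<in>Fpow L. \<forall>t\<in>Fpow L. card s = card t \<longrightarrow> A s = A t"
  \<comment> \<open>\<open>FDP\<close> contains every singleton of \<open>FDP_index\<close>, so an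
    FDP-distribution must be \<open>top\<close> on singletons.\<close>
  define A' where "A' s = (if card s \<le> 1 then top else A s)" for s
  have AU: "A s \<in> U" if "s \<in> Fpow L" for s
    using A that by (auto simp: distribution_in_def)
  have A_mono: "A t \<le> A s" if "t \<in> Fpow L" "s \<subseteq> t" for s t
    using A that by (auto simp: distribution_in_def distribution_def Fpow_def finite_subset)
  have A'U: "A' s \<in> U" if "s \<in> Fpow L" for s
    using AU[OF that] by (simp add: A'_def ultrafilter_top)
  have A'_mono: "A' t \<le> A' s" if "t \<in> Fpow L" "s \<subseteq> t" for s t
    using A_mono[OF that] card_mono[of t s] that by (auto simp: A'_def Fpow_def)
  have A'_uniform: "A' s = A' t" if "s \<in> Fpow L" "t \<in> Fpow L" "card s = card t" for s t
    using uniform that unfolding A'_def by metis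
  have "A' {} = top" by (simp add: A'_def)
  then have dist_in: "distribution_in U L A'" using A'U A'_mono by (rule distribution_inI)
  have "\<exists>f. f ` s \<subseteq> FDP_index \<and> (\<forall>t\<subseteq>s. c \<le> A' t \<longleftrightarrow> f ` t \<in> FDP)"
    if s: "s \<in> Fpow L" for s and c :: 'b
  proof -
    have sub: "t \<in> Fpow L" if "t \<subseteq> s" for t
      using that s by (auto simp: Fpow_def finite_subset)
    have fin: "finite s" using s by (simp add: Fpow_def)
    let ?K = "card ` {t. t \<subseteq> s \<and> c \<le> A' t}"
    \<comment> \<open>The column is the largest accepted size. \<open>?K\<close> contains 0, and the
      maximum with 1 keeps \<open>m\<close> in the index set when \<open>s\<close> is empty.\<close>
    define m where "m = max 1 (Max ?K)"
    have finK: "finite ?K" using fin by simp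
    have neK: "?K \<noteq> {}" by (auto simp: A'_def intro!: exI[of _ "{}"])
    \<comment> \<open>Injectivity makes \<open>f\<close> preserve cardinalities, so membership in
      \<open>FDP\<close> becomes a bound on \<open>card t\<close>.\<close>
    obtain h :: "'l \<Rightarrow> nat" where h: "inj_on h s"
      using finite_imp_inj_to_nat_seg[OF fin] by blast
    define f where "f \<alpha> = (m, h \<alpha>)" for \<alpha>
    have inj: "inj_on f s" using h by (auto simp: f_def inj_on_def)
    have "c \<le> A' t \<longleftrightarrow> card t \<le> m" if t: "t \<subseteq> s" for t
    proof
      assume "c \<le> A' t"
      then show "card t \<le> m" using finK t
        by (auto simp: m_def intro!: le_max_iff_disj[THEN iffD2] Max_ge)
    next
      assume le: "card t \<le> m"
      show "c \<le> A' t"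
      proof (cases "card t \<le> 1")
        case True
        then show ?thesis by (simp add: A'_def)
      next
        case False
        then have "card t \<le> Max ?K" using le by (auto simp: m_def)
        \<comment> \<open>Shrink an accepted set of maximal size to size \<open>card t\<close>;
          monotonicity accepts the smaller set and uniformity transfers this to
          \<open>t\<close>.\<close>
        moreover obtain u where u: "u \<subseteq> s" "c \<le> A' u" "card u = Max ?K"
          using Max_in[OF finK neK] by auto
        ultimately obtain v where v: "v \<subseteq> u" "card v = card t"
          using obtain_subset_with_card_n[of "card t" u] by metis
        have "c \<le> A' v" using u A'_mono[OF sub v(1)] by (auto intro: order_trans)
        then show ?thesis using A'_uniform[of v t] sub t u v by auto
      qed
    qed
    moreover have "f ` t \<in> FDP \<longleftrightarrow> card t \<le> m" if t: "t \<subseteq> s" for t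
    proof -
      have "card (f ` t) = card t" using inj t by (intro card_image) (auto intro: inj_on_subset)
      moreover have "finite (f ` t)" using t fin by (auto intro: finite_subset)
      moreover have "f ` t \<subseteq> {m} \<times> UNIV" "m \<ge> 1" by (auto simp: f_def m_def)
      ultimately show ?thesis using FDP_iff_card_le by metis
    qed
    moreover have "f ` s \<subseteq> FDP_index" by (auto simp: f_def FDP_index_def m_def)
    ultimately show ?thesis by blast
  qed
  then have "pattern_distribution L FDP_index FDP A'"
    using dist_in unfolding pattern_distribution_def distribution_in_def by blast
  from refinements[OF this dist_in] obtain b where
    b: "\<forall>\<alpha>\<in>L. b \<alpha> \<in> U" "\<forall>s\<in>Fpow L. (INF \<alpha>\<in>s. b \<alpha>) \<le> A' s"
    unfolding has_multiplicative_refinement_iff by blast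
  \<comment> \<open>On sets of size at most 1 the bound by \<open>A'\<close> is vacuous; the factors
    \<open>A {\<alpha>}\<close> recover what was discarded there.\<close>
  have "(INF \<alpha>\<in>s. inf (b \<alpha>) (A {\<alpha>})) \<le> A s" if s: "s \<in> Fpow L" for s
  proof -
    have "finite s" using s by (simp add: Fpow_def)
    then consider "s = {}" | \<alpha> where "s = {\<alpha>}" | "card s > 1"
      by (metis card_0_eq card_1_singletonE less_one nat_neq_iff)
    then show ?thesis
    proof cases
      case 1
      then show ?thesis using A by (simp add: distribution_in_def distribution_def)
    next
      case 2
      then show ?thesis by simp
    next
      case 3
      have "(INF \<alpha>\<in>s. inf (b \<alpha>) (A {\<alpha>})) \<le> (INF \<alpha>\<in>s. b \<alpha>)" by (intro INF_mono') simp
      also have "\<dots> \<le> A' s" using b(2) s by blast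
      finally show ?thesis using 3 by (simp add: A'_def)
    qed
  qed
  moreover have "\<forall>\<alpha>\<in>L. inf (b \<alpha>) (A {\<alpha>}) \<in> U"
    using b(1) AU by (auto intro!: ultrafilter_inf simp: Fpow_def)
  ultimately show "has_multiplicative_refinement U L A"
    unfolding has_multiplicative_refinement_iff
    by (intro exI[of _ "\<lambda>\<alpha>. inf (b \<alpha>) (A {\<alpha>})"]) blast
qed

lemma exchange_card_image:
  assumes fin: "finite t" "finite r" and ne: "r \<noteq> {}" and new: "f \<alpha> \<notin> f ` t"
  obtains x where "x \<in> r" "card (f ` (t \<union> r)) \<le> card (f ` (insert \<alpha> t \<union> (r - {x})))"
proof (cases "f \<alpha> \<in> f ` r")
  case True
  then obtain x where x: "x \<in> r" "f x = f \<alpha>" by auto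
  then have "f ` (t \<union> r) \<subseteq> f ` (insert \<alpha> t \<union> (r - {x}))" by auto
  then show ?thesis using that x(1) fin by (meson card_mono finite.insertI finite_Diff finite_UnI finite_imageI)
next
  case False
  obtain x where x: "x \<in> r" using ne by auto
  have "card (f ` (t \<union> r)) = Suc (card (f ` (t \<union> r) - {f x}))"
    using x fin by (subst card.remove[of _ "f x"]) auto
  also have "\<dots> = card (insert (f \<alpha>) (f ` (t \<union> r) - {f x}))"
    using new False fin by (subst card_insert_disjoint) auto
  also have "\<dots> \<le> card (f ` (insert \<alpha> t \<union> (r - {x})))"
    using fin by (intro card_mono) auto
  finally show ?thesis using that x by blast
qed

text \<open>Truth value of: some \<open>r\<close> with \<open>|r| \<le> j\<close>, in the column of \<open>p\<close>, is such that \<open>t \<union> r\<close> is too large.\<close>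

definition overflow :: "'l set \<Rightarrow> ('l set \<Rightarrow> 'b) \<Rightarrow> 'l \<Rightarrow> 'l set \<Rightarrow> nat \<Rightarrow> 'b" where
  "overflow L A p t j =
     (SUP r\<in>{r\<in>Fpow L. card r \<le> j}. inf (INF \<beta>\<in>r. A {p, \<beta>}) (- A (t \<union> r)))"

lemma overflow_upper:
  assumes "r \<in> Fpow L" "card r \<le> j"
  shows "inf (INF \<beta>\<in>r. A {p, \<beta>}) (- A (t \<union> r)) \<le> overflow L A p t j"
  unfolding overflow_def using assms by (intro SUP_upper) auto

lemma overflow_mono: "i \<le> j \<Longrightarrow> overflow L A p t i \<le> overflow L A p t j"
  unfolding overflow_def by (intro SUP_subset_mono) auto

lemma overflow_0: "overflow L A p t 0 = - A t"
proof -
  have "{r\<in>Fpow L. card r \<le> 0} = {{}}" by (auto simp: Fpow_def)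
  then show ?thesis by (simp add: overflow_def)
qed

text \<open>On a nonzero part where the refinement fails, decide everything relevant and realise it
  by some \<open>f\<close>. A point of \<open>f\<close> s\<open>outside\<close>f \<open>t\<close>
  could be exchanged for a point of \<open>r\<close>, giving an overflow of
  \<open>insert \<alpha> t\<close> at level \<open>j\<close>, which \<open>b \<alpha>\<close>
  excludes. Hence \<open>f\<close> s \<subseteq> f \<open>t\<close>, and \<open>s\<close> is
  accepted because \<open>t\<close> is.\<close>

lemma FDP_bounded_column:
  fixes L :: "'l set"
  assumes A: "pattern_distribution L FDP_index FDP A"
    and t: "t \<in> Fpow L" "p \<in> t" and s: "s \<in> Fpow L" "\<alpha>0 \<in> s"
    and b: "\<And>\<alpha>. b \<alpha> = inf (inf (A {p, \<alpha>}) (A t))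
      (inf (overflow L A p t (Suc j)) (- overflow L A p (insert \<alpha> t) j))"
  shows "(INF \<alpha>\<in>s. b \<alpha>) \<le> A s"
proof (rule ccontr)
  assume not_refined: "\<not> ?thesis"
  define c0 where "c0 = inf (INF \<alpha>\<in>s. b \<alpha>) (- A s)"
  have c0: "c0 \<noteq> bot" using not_refined by (simp add: c0_def inf_shunt)
  have c0_b: "c0 \<le> b \<alpha>" if "\<alpha> \<in> s" for \<alpha>
    unfolding c0_def using that by (intro le_infI1 INF_lower)
  have "c0 \<le> overflow L A p t (Suc j)" using c0_b[OF s(2)] by (simp add: b)
  then obtain r where r: "r \<in> Fpow L" "card r \<le> Suc j"
    and r': "inf c0 (inf (INF \<beta>\<in>r. A {p, \<beta>}) (- A (t \<union> r))) \<noteq> bot"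
    using inf_neq_bot_if_le_SUP[OF c0] unfolding overflow_def by blast
  let ?S = "s \<union> t \<union> r"
  have S: "?S \<in> Fpow L" using s t r by (auto simp: Fpow_def)
  then have fin: "finite ?S" by (simp add: Fpow_def)
  then have "finite (A ` Pow ?S)" by simp
  from exists_deciding[OF this r'] obtain c where c: "c \<noteq> bot"
    "c \<le> inf c0 (inf (INF \<beta>\<in>r. A {p, \<beta>}) (- A (t \<union> r)))" "\<forall>x\<in>A ` Pow ?S. decides c x"
    by blast
  then have c_c0: "c \<le> c0" and c_r: "c \<le> (INF \<beta>\<in>r. A {p, \<beta>})" and c_tr: "c \<le> - A (t \<union> r)"
    by simp_all
  from A S c obtain f where f: "f ` ?S \<subseteq> FDP_index" "\<forall>u\<subseteq>?S. c \<le> A u \<longleftrightarrow> f ` u \<in> FDP"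
    unfolding pattern_distribution_def by (metis PowI image_eqI)
  have not_le: "\<not> c \<le> x" if "c \<le> - x" for x
    using that c(1) by (metis bot.extremum_uniqueI inf_compl_bot le_inf_iff)
  have c_b: "c \<le> b \<alpha>" if "\<alpha> \<in> s" for \<alpha> using c_c0 c0_b[OF that] by (rule order_trans)
  obtain m k where p: "f p = (m, k)" by (cases "f p")
  have "c \<le> A t" using c_b[OF s(2)] by (simp add: b)
  then have ft: "f ` t \<in> FDP" using f(2) by auto
  have "(m, k) \<in> f ` t" using t(2) p by (metis image_eqI)
  note ft = FDP_column[OF ft this]
  \<comment> \<open>An accepted pair \<open>{p, \<beta>}\<close> lies in a single column; this
    places both \<open>s\<close> and \<open>r\<close> in the column \<open>m\<close> of
    \<open>p\<close>.\<close>
  have col: "f \<beta> \<in> {m} \<times> UNIV" if "c \<le> A {p, \<beta>}" "\<beta> \<in> ?S" for \<beta>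
  proof -
    have "{p, \<beta>} \<subseteq> ?S" using that(2) t(2) by simp
    then have "f ` {p, \<beta>} \<in> FDP" using f(2) that(1) by (simp only:)
    moreover have "(m, k) \<in> f ` {p, \<beta>}" using p by simp
    ultimately show ?thesis using FDP_column(2) by blast
  qed
  have c_r': "c \<le> A {p, \<beta>}" if "\<beta> \<in> r" for \<beta>
    using c_r INF_lower[OF that] by (rule order_trans)
  have fr: "f ` r \<subseteq> {m} \<times> UNIV" using col c_r' by blast
  have fs: "f ` s \<subseteq> {m} \<times> UNIV" using col c_b by (intro image_subsetI) (simp add: b)
  have FDP_iff: "c \<le> A u \<longleftrightarrow> card (f ` u) \<le> m" if u: "u \<subseteq> ?S" "f ` u \<subseteq> {m} \<times> UNIV" for u
  proof -
    have "c \<le> A u \<longleftrightarrow> f ` u \<in> FDP" using f(2) u(1) by (simp only:)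
    also have "\<dots> \<longleftrightarrow> card (f ` u) \<le> m"
      using u(2) ft(1) finite_subset[OF u(1) fin] by (intro FDP_iff_card_le) auto
    finally show ?thesis .
  qed
  have "t \<union> r \<subseteq> ?S" "f ` (t \<union> r) \<subseteq> {m} \<times> UNIV" using ft(2) fr by auto
  then have big: "card (f ` (t \<union> r)) > m"
    using FDP_iff not_le[OF c_tr] by (metis linorder_not_le)
  have rne: "r \<noteq> {}" using big ft(3) by auto
  have "f \<alpha> \<in> f ` t" if \<alpha>: "\<alpha> \<in> s" for \<alpha>
  proof (rule ccontr)
    assume "f \<alpha> \<notin> f ` t"
    with rne fin obtain x where x: "x \<in> r"
      "card (f ` (t \<union> r)) \<le> card (f ` (insert \<alpha> t \<union> (r - {x})))"
      using exchange_card_image[of t r f \<alpha>] by auto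
    \<comment> \<open>\<open>?r\<close> has at most \<open>j\<close> elements and \<open>?u\<close>
      is too large for column \<open>m\<close>, so \<open>?r\<close> witnesses the forbidden
      overflow.\<close>
    let ?r = "r - {x}" and ?u = "insert \<alpha> t \<union> (r - {x})"
    have u: "?u \<subseteq> ?S" "f ` ?u \<subseteq> {m} \<times> UNIV" using \<alpha> fs fr ft(2) by auto
    then have "\<not> c \<le> A ?u" using FDP_iff[of ?u] big x(2) by simp
    moreover have "decides c (A ?u)" using c(3) u(1) by blast
    ultimately have "c \<le> - A ?u" by (simp add: decides_def inf_shunt)
    moreover have "c \<le> (INF \<beta>\<in>?r. A {p, \<beta>})" using c_r' by (intro INF_greatest) auto
    moreover have "card ?r \<le> j" using r(2) x(1) fin by simp
    moreover have "?r \<in> Fpow L" using r by (auto simp: Fpow_def)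
    ultimately have "c \<le> overflow L A p (insert \<alpha> t) j"
      using overflow_upper[of ?r L j A p "insert \<alpha> t"] by (meson le_inf_iff order_trans)
    moreover have "c \<le> - overflow L A p (insert \<alpha> t) j" using c_b[OF \<alpha>] by (simp add: b)
    ultimately show False using not_le by blast
  qed
  then have "card (f ` s) \<le> card (f ` t)" using fin by (intro card_mono) auto
  then have "c \<le> A s" using FDP_iff[of s] fs ft(3) by auto
  moreover have "c \<le> - A s" using c_c0 by (simp add: c0_def)
  ultimately show False using not_le by blast
qed

text \<open>Columns have index at least 1, so every one-point image lies in \<open>FDP\<close>. A
  nonzero \<open>- A {\<alpha>}\<close> would decide all subsets of \<open>{\<alpha>}\<close> and be
  forced below \<open>A {\<alpha>}\<close>.\<close>

lemma FDP_distribution_singleton: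
  fixes L :: "'l set"
  assumes A: "pattern_distribution L FDP_index FDP A" and "\<alpha> \<in> L"
  shows "A {\<alpha>} = top"
proof (rule ccontr)
  assume "A {\<alpha>} \<noteq> top"
  then have c: "- A {\<alpha>} \<noteq> bot" by (metis compl_bot_eq double_compl)
  have "A {} = top" using A by (auto simp: pattern_distribution_def distribution_def)
  then have "\<forall>t\<subseteq>{\<alpha>}. decides (- A {\<alpha>}) (A t)"
    by (auto simp: decides_def subset_singleton_iff)
  moreover have "{\<alpha>} \<in> Fpow L" using assms(2) by (simp add: Fpow_def)
  ultimately obtain f where f: "f ` {\<alpha>} \<subseteq> FDP_index" "- A {\<alpha>} \<le> A {\<alpha>} \<longleftrightarrow> f ` {\<alpha>} \<in> FDP"
    using A c unfolding pattern_distribution_def by (metis order_refl)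
  have "f ` {\<alpha>} \<in> FDP" using f(1) by (cases "f \<alpha>") (auto simp: FDP_def FDP_index_def)
  then have "- A {\<alpha>} \<le> A {\<alpha>}" using f(2) by blast
  then show False using c by (metis inf.absorb1 inf_commute inf_compl_bot)
qed

lemma FDP_refinement_if_OK:
  fixes L :: "'l set"
  assumes OK: "OK U L" and A: "pattern_distribution L FDP_index FDP A" "distribution_in U L A"
  shows "has_multiplicative_refinement U L A"
proof (cases "L = {}")
  case True
  then show ?thesis
    using A(2) unfolding has_multiplicative_refinement_iff
    by (auto simp: Fpow_def distribution_in_def distribution_def)
next
  case False
  then obtain p where p: "p \<in> L" by blast
  have AU: "A s \<in> U" if "s \<in> Fpow L" for s
    using A(2) that by (auto simp: distribution_in_def)
  have pair: "A {p, \<alpha>} \<in> U" if "\<alpha> \<in> L" for \<alpha>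
    using AU p that by (simp add: Fpow_def)
  have A_empty: "A {} = top" using A(2) by (simp add: distribution_in_def distribution_def)
  show ?thesis
  proof (cases "\<exists>j t. t \<in> Fpow L \<and> p \<in> t \<and> overflow L A p t j \<in> U")
    case True
    then obtain j where j: "\<exists>t. t \<in> Fpow L \<and> p \<in> t \<and> overflow L A p t j \<in> U"
      and least: "\<And>i. i < j \<Longrightarrow> \<not> (\<exists>t. t \<in> Fpow L \<and> p \<in> t \<and> overflow L A p t i \<in> U)"
      using exists_least_iff[of "\<lambda>j. \<exists>t. t \<in> Fpow L \<and> p \<in> t \<and> overflow L A p t j \<in> U"] by metis
    then obtain t where t: "t \<in> Fpow L" "p \<in> t" "overflow L A p t j \<in> U" by blast
    \<comment> \<open>At level 0 the overflow is \<open>- A t\<close>, which is not in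
      \<open>U\<close>. So there is a level \<open>i\<close> just below \<open>j\<close>, and
      minimality applies there to every \<open>insert \<alpha> t\<close>.\<close>
    have "j \<noteq> 0" using t(3) ultrafilter_uminus_notin[OF AU[OF t(1)]] by (metis overflow_0)
    then obtain i where i: "j = Suc i" using not0_implies_Suc by blast
    define b where "b \<alpha> = inf (inf (A {p, \<alpha>}) (A t))
      (inf (overflow L A p t (Suc i)) (- overflow L A p (insert \<alpha> t) i))" for \<alpha>
    have "b \<alpha> \<in> U" if "\<alpha> \<in> L" for \<alpha>
    proof -
      have "insert \<alpha> t \<in> Fpow L" "p \<in> insert \<alpha> t" using that t by (auto simp: Fpow_def)
      then have "overflow L A p (insert \<alpha> t) i \<notin> U" using least[of i] i by blast
      then show ?thesis unfolding b_def
        using that t AU pair i by (intro ultrafilter_inf ultrafilter_uminus) auto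
    qed
    moreover have "(INF \<alpha>\<in>s. b \<alpha>) \<le> A s" if "s \<in> Fpow L" for s
    proof (cases "s = {}")
      case True
      then show ?thesis by (simp add: A_empty)
    next
      case False
      then show ?thesis
        using FDP_bounded_column[OF A(1) t(1,2) that _ b_def] by blast
    qed
    ultimately show ?thesis unfolding has_multiplicative_refinement_iff by blast
  next
    case False
    \<comment> \<open>With no overflow in \<open>U\<close>, these complements form a distribution
      depending only on size. It starts at \<open>top\<close> because
      \<open>A {p} = top\<close>.\<close>
    define D where "D s = - overflow L A p {p} (card s)" for s :: "'l set"
    have DU: "D s \<in> U" for s
      using False p unfolding D_def by (intro ultrafilter_uminus) (auto simp: Fpow_def)
    have "D {} = top"
      using FDP_distribution_singleton[OF A(1) p] by (simp add: D_def overflow_0)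
    moreover have "D t \<le> D s" if "t \<in> Fpow L" "s \<subseteq> t" for s t
      using that unfolding D_def by (auto intro!: overflow_mono card_mono simp: Fpow_def)
    ultimately have "distribution_in U L D" using DU by (intro distribution_inI)
    moreover have "\<forall>s\<in>Fpow L. \<forall>t\<in>Fpow L. card s = card t \<longrightarrow> D s = D t"
      by (simp add: D_def)
    ultimately have "has_multiplicative_refinement U L D" using OK unfolding OK_def by blast
    then obtain b where b: "\<forall>\<alpha>\<in>L. b \<alpha> \<in> U" "\<forall>s\<in>Fpow L. (INF \<alpha>\<in>s. b \<alpha>) \<le> D s"
      unfolding has_multiplicative_refinement_iff by blast
    have "(INF \<alpha>\<in>s. inf (b \<alpha>) (A {p, \<alpha>})) \<le> A s" if s: "s \<in> Fpow L" for s
    proof -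
      let ?P = "INF \<alpha>\<in>s. A {p, \<alpha>}"
      have "(INF \<alpha>\<in>s. inf (b \<alpha>) (A {p, \<alpha>})) = inf (INF \<alpha>\<in>s. b \<alpha>) ?P"
        by (simp add: INF_inf_distrib)
      also have "\<dots> \<le> inf (D s) ?P" using b(2) s by (intro inf_mono) auto
      \<comment> \<open>The set \<open>s\<close> itself is an admissible \<open>r\<close> in the
        overflow whose complement is \<open>D s\<close>.\<close>
      also have "\<dots> \<le> A ({p} \<union> s)"
      proof -
        have "inf ?P (- A ({p} \<union> s)) \<le> - D s"
          using overflow_upper[of s L "card s" A p "{p}"] s by (simp add: D_def)
        then have "inf (inf ?P (- A ({p} \<union> s))) (D s) = bot" by (simp add: inf_shunt)
        then have "inf (inf (D s) ?P) (- A ({p} \<union> s)) = bot" by (simp add: ac_simps)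
        then show ?thesis by (simp add: inf_shunt)
      qed
      also have "\<dots> \<le> A s"
        using A(2) s p unfolding distribution_in_def distribution_def
        by (auto simp: Fpow_def subset_insertI)
      finally show ?thesis .
    qed
    moreover have "\<forall>\<alpha>\<in>L. inf (b \<alpha>) (A {p, \<alpha>}) \<in> U"
      using b(1) pair by (auto intro: ultrafilter_inf)
    ultimately show ?thesis unfolding has_multiplicative_refinement_iff
      by (intro exI[of _ "\<lambda>\<alpha>. inf (b \<alpha>) (A {p, \<alpha>})"]) blast
  qed
qed

section \<open>Flexible ultrafilters\<close>

lemma flexible_if_OK:
  assumes OK: "OK U L" and "aleph1_incomplete U"
  shows "flexible U L"
  unfolding flexible_def
proof (intro conjI ballI impI assms(2))
  fix n :: "nat \<Rightarrow> 'b"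
  assume n: "n \<in> nat_names" "nonstandard U n"
  let ?A = "\<lambda>s. val_ge n (card s)"
  have "val_ge n 0 = top" using n(1) by (simp add: val_ge_def nat_names_def)
  moreover have "val_ge n k \<le> val_ge n i" if "i \<le> k" for i k
    unfolding val_ge_def using that by (intro SUP_subset_mono) auto
  moreover have "val_ge n k \<in> U" for k
    using n(2) by (simp add: nonstandard_def)
  ultimately have "distribution_in U L ?A"
    by (intro distribution_inI) (auto simp: Fpow_def card_mono)
  then have "has_multiplicative_refinement U L ?A" using OK unfolding OK_def by simp
  then show "\<exists>B. distribution_in U L B \<and> multiplicative L B \<and>
      (\<forall>s\<in>Fpow L. B s \<le> val_ge n (card s))"
    unfolding has_multiplicative_refinement_def refines_def .
qed

text \<open>The name takes value \<open>k\<close> on the layer between \<open>b k\<close> and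
  \<open>b (Suc k)\<close>; the layers from \<open>k\<close> on fill \<open>b k\<close> because the
  sequence has meet \<open>bot\<close>.\<close>

lemma name_of_decreasing_sequence:
  fixes b :: "nat \<Rightarrow> 'b"
  assumes "b 0 = top" "antimono b" "(INF k. b k) = bot"
  obtains n where "n \<in> nat_names" "\<And>k. val_ge n k = b k"
proof
  define n where "n k = inf (b k) (- b (Suc k))" for k
  have upper: "val_ge n k \<le> b k" for k
    unfolding val_ge_def n_def
    by (intro SUP_least le_infI1) (use assms(2) in \<open>auto dest: antimonoD\<close>)
  have lower: "b k \<le> val_ge n k" for k
  proof -
    \<comment> \<open>The part of \<open>b k\<close> missed by all later layers never leaves the
      sequence: it stays below every \<open>b (k + i)\<close>, hence below their meet.\<close>
    define z where "z = inf (b k) (- val_ge n k)"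
    have "z \<le> b (k + i)" for i
    proof (induction i)
      case 0
      then show ?case by (simp add: z_def)
    next
      case (Suc i)
      have "n (k + i) \<le> val_ge n k" unfolding val_ge_def by (intro SUP_upper) simp
      then have "z \<le> - n (k + i)" unfolding z_def by (intro le_infI2) simp
      then have "inf z (inf (b (k + i)) (- b (Suc (k + i)))) = bot"
        by (simp add: n_def inf_shunt)
      moreover have "inf z (b (k + i)) = z" using Suc.IH by (simp add: inf.absorb1)
      ultimately have "inf z (- b (Suc (k + i))) = bot" by (metis inf_assoc)
      then show ?case by (simp add: inf_shunt)
    qed
    then have "z \<le> b i" for i
      using antimonoD[OF assms(2), of i "k + i"] by (metis le_add2 order_trans)
    then have "z = bot" using assms(3) by (metis INF_greatest bot.extremum_uniqueI)
    then show ?thesis by (simp add: z_def inf_shunt)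
  qed
  show val: "val_ge n k = b k" for k using upper lower by (rule antisym)
  have "inf (n i) (n j) = bot" if "i < j" for i j
  proof -
    have "n j \<le> b (Suc i)"
      unfolding n_def using that antimonoD[OF assms(2), of "Suc i" j] by (intro le_infI1) simp
    then have "inf (n i) (n j) \<le> inf (- b (Suc i)) (b (Suc i))"
      by (intro inf_mono) (simp add: n_def)
    then show ?thesis by (simp add: bot_unique)
  qed
  then have "inf (n i) (n j) = bot" if "i \<noteq> j" for i j
    using that by (metis inf_commute nat_neq_iff)
  then show "n \<in> nat_names"
    using val[of 0] assms(1) by (simp add: nat_names_def val_ge_def)
qed

lemma OK_if_flexible:
  fixes L :: "'l set"
  assumes flex: "flexible U L"
  shows "OK U L"
  unfolding OK_def
proof (intro allI impI, elim conjE)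
  fix A :: "'l set \<Rightarrow> 'b"
  assume A: "distribution_in U L A"
    and uniform: "\<forall>s\<in>Fpow L. \<forall>t\<in>Fpow L. card s = card t \<longrightarrow> A s = A t"
  obtain X where X: "X \<subseteq> U" "countable X" "Inf X = bot"
    using flex unfolding flexible_def aleph1_incomplete_def by blast
  have "X \<noteq> {}" using X(3) ultrafilter_top ultrafilter_bot by auto
  then obtain x :: "nat \<Rightarrow> 'b" where x: "X = range x"
    using X(2) range_from_nat_into by metis
  \<comment> \<open>Taking all sizes up to \<open>k\<close> makes the sequence decreasing and keeps
    it meaningful when \<open>L\<close> has fewer than \<open>k\<close> elements. Meeting with the
    first \<open>k\<close> members of \<open>X\<close> then forces the meet of the
    \<open>b k\<close> to be \<open>bot\<close>, while \<open>b 0\<close> remains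
    \<open>top\<close>.\<close>
  define a where "a k = Inf (A ` {s\<in>Fpow L. card s \<le> k})" for k
  define b where "b k = inf (a k) (INF i\<in>{..<k}. x i)" for k
  have aU: "a k \<in> U" for k
  proof -
    let ?S = "{s\<in>Fpow L. card s \<le> k}"
    \<comment> \<open>By uniformity one representative per size suffices, so this possibly infinite
      meet has finitely many distinct terms. Sizes not realised in \<open>L\<close> only enlarge the
      right-hand side.\<close>
    have "A ` ?S \<subseteq> (\<lambda>i. A (SOME s. s \<in> Fpow L \<and> card s = i)) ` {..k}"
    proof
      fix y assume "y \<in> A ` ?S"
      then obtain s where s: "s \<in> Fpow L" "card s \<le> k" "y = A s" by blast
      let ?u = "SOME u. u \<in> Fpow L \<and> card u = card s"
      have "?u \<in> Fpow L \<and> card ?u = card s" by (rule someI[of _ s]) (use s in simp)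
      then have "y = A ?u" using uniform s by metis
      then show "y \<in> (\<lambda>i. A (SOME s. s \<in> Fpow L \<and> card s = i)) ` {..k}" using s(2) by blast
    qed
    then have "finite (A ` ?S)" by (rule finite_subset) simp
    moreover have "A ` ?S \<subseteq> U" using A by (auto simp: distribution_in_def)
    ultimately show ?thesis using ultrafilter_INF[of "A ` ?S" id] by (auto simp: a_def)
  qed
  have bU: "b k \<in> U" for k
    unfolding b_def using aU X(1) x by (intro ultrafilter_inf ultrafilter_INF) auto
  have "a 0 = top"
  proof -
    have "{s\<in>Fpow L. card s \<le> 0} = {{}}" by (auto simp: Fpow_def)
    then show ?thesis using A by (simp add: a_def distribution_in_def distribution_def)
  qed
  then have "b 0 = top" by (simp add: b_def)
  moreover have "antimono b"
    unfolding b_def a_def by (intro antimonoI inf_mono INF_superset_mono) auto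
  moreover have "(INF k. b k) = bot"
  proof -
    have "(INF k. b k) \<le> x i" for i
      \<comment> \<open>The index is \<open>Suc i\<close> because \<open>b k\<close> includes only
        the \<open>x i\<close> with \<open>i < k\<close>.\<close>
      by (rule order_trans[OF INF_lower[of "Suc i"]]) (auto simp: b_def intro: le_infI2 INF_lower)
    then have "(INF k. b k) \<le> Inf X" unfolding x by (intro INF_greatest)
    then show ?thesis using X(3) by (simp add: bot_unique)
  qed
  ultimately obtain n where n: "n \<in> nat_names" "\<And>k. val_ge n k = b k"
    using name_of_decreasing_sequence by blast
  have "nonstandard U n" using bU n(2) by (simp add: nonstandard_def)
  then obtain B where B: "distribution_in U L B" "multiplicative L B"
      "\<forall>s\<in>Fpow L. B s \<le> val_ge n (card s)"
    using flex n(1) unfolding flexible_def by blast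
  have "b (card s) \<le> A s" if "s \<in> Fpow L" for s
    unfolding b_def a_def using that by (intro le_infI1 INF_lower) simp
  then have "refines L B A"
    using B(3) n(2) unfolding refines_def by (metis order_trans)
  then show "has_multiplicative_refinement U L A"
    using B(1,2) unfolding has_multiplicative_refinement_def by blast
qed

end

theorem theorem8p12:
  fixes U :: "'b::{boolean_algebra, complete_lattice} set"
  assumes "ultrafilter U"
  shows "(lambda_of U FDP_index FDP :: 'l rel set) =
           least_cardinal (\<lambda>\<kappa>. \<not> OK U (Field \<kappa>)) \<and>
         (aleph1_incomplete U \<longrightarrow>
           (lambda_of U FDP_index FDP :: 'l rel set) =
             least_cardinal (\<lambda>\<kappa>. \<not> flexible U (Field \<kappa>)))"
proof -
  have "(\<exists>A. pattern_distribution L FDP_index FDP A \<and> distribution_in U L A \<and>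
         \<not> has_multiplicative_refinement U L A) \<longleftrightarrow> \<not> OK U L" for L :: "'l set"
    using OK_if_FDP_refinements[OF assms, of L] FDP_refinement_if_OK[OF assms, of L] by blast
  moreover have "OK U L \<longleftrightarrow> flexible U L" if "aleph1_incomplete U" for L :: "'l set"
    using flexible_if_OK[OF assms _ that] OK_if_flexible[OF assms] by blast
  ultimately show ?thesis unfolding lambda_of_def by simp
qed

end
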